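(* Let $(\Omega,(\mathcal F_k)_{k=0}^n,\mathbb P)$ be a filtered probability space and let $(F_k)_{k=0}^n$ be an integrable $(\mathcal F_k)$-martingale with differences $\Delta F_k=F_k-F_{k-1}$. Then $$\mathbb E\Big(\sum_{k=1}^n\big(\mathbb E_{k-1}|\Delta F_k|\big)^2\Big)^{1/2}\le 2\,\mathbb E\Big(\sum_{k=1}^n|\Delta F_k|^2\Big)^{1/2}.$$
   Context: $\mathbb E$ is expectation on $(\Omega,\mathbb P)$ and $\mathbb E_k$ is conditional expectation with respect to $\mathcal F_k$. The martingale is complex (or real) valued; the right-hand side may be $+\infty$. *)

theory Defs
  imports "HOL-Probability.Probability"
begin

text \<open>The library's conditional expectation is real valued; for complex functions it is taken
  separately on the real and the imaginary part.\<close>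

definition complex_cond_exp :: "'a measure \<Rightarrow> 'a measure \<Rightarrow> ('a \<Rightarrow> complex) \<Rightarrow> 'a \<Rightarrow> complex" where
  "complex_cond_exp M G f =
    (\<lambda>\<omega>. Complex (real_cond_exp M G (\<lambda>x. Re (f x)) \<omega>) (real_cond_exp M G (\<lambda>x. Im (f x)) \<omega>))"

text \<open>Only the members with index at most \<open>n\<close> of the sequences below are constrained:
  they represent filtrations and processes indexed by \<open>{0..n}\<close>.\<close>

definition filtered_prob_space :: "'a measure \<Rightarrow> (nat \<Rightarrow> 'a measure) \<Rightarrow> nat \<Rightarrow> bool" where
  "filtered_prob_space M \<F> n \<longleftrightarrow>
    prob_space M \<and> (\<forall>k\<le>n. subalgebra M (\<F> k)) \<and>
    (\<forall>i j. i \<le> j \<and> j \<le> n \<longrightarrow> sets (\<F> i) \<subseteq> sets (\<F> j))"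

definition integrable_martingale ::
    "'a measure \<Rightarrow> (nat \<Rightarrow> 'a measure) \<Rightarrow> nat \<Rightarrow> (nat \<Rightarrow> 'a \<Rightarrow> complex) \<Rightarrow> bool" where
  "integrable_martingale M \<F> n F \<longleftrightarrow>
    (\<forall>k\<le>n. F k \<in> borel_measurable (\<F> k) \<and> integrable M (F k)) \<and>
    (\<forall>k\<in>{1..n}. AE \<omega> in M. complex_cond_exp M (\<F> (k - 1)) (F k) \<omega> = F (k - 1) \<omega>)"

definition mart_diff :: "(nat \<Rightarrow> 'a \<Rightarrow> complex) \<Rightarrow> nat \<Rightarrow> 'a \<Rightarrow> complex" where
  "mart_diff F k \<omega> = F k \<omega> - F (k - 1) \<omega>"

end

theory Submission
  imports Defs
begin

text \<open>Let \<open>g\<^sub>k = E\<^sub>k\<^sub>-\<^sub>1 f\<^sub>k\<close>, where \<open>f\<^sub>k = \<bar>\<Delta>F\<^sub>k\<bar>\<close>, and linearise the left-hand square function: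
  it equals \<open>\<Sum> g\<^sub>k u\<^sub>k\<close> with \<open>u\<^sub>k = g\<^sub>k / (\<Sum> g\<^sub>j\<^sup>2)\<^sup>1\<^sup>/\<^sup>2\<close>, so that \<open>\<Sum> u\<^sub>k\<^sup>2 \<le> 1\<close>. With
  \<open>v\<^sub>k = E\<^sub>k\<^sub>-\<^sub>1 u\<^sub>k\<close> one has \<open>E (g\<^sub>k u\<^sub>k) = E (f\<^sub>k v\<^sub>k)\<close>. For the partial square functions \<open>S\<^sub>k\<close> of the
  \<open>f\<^sub>k\<close>, the AM-GM inequality gives \<open>f\<^sub>k v\<^sub>k \<le> 3/2 (S\<^sub>k - S\<^sub>k\<^sub>-\<^sub>1) + 1/2 v\<^sub>k\<^sup>2 S\<^sub>k\<^sub>-\<^sub>1\<close>. Since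
  \<open>S\<^sub>k\<^sub>-\<^sub>1\<close> is measurable at time \<open>k - 1\<close>, \<open>E (v\<^sub>k\<^sup>2 S\<^sub>k\<^sub>-\<^sub>1) \<le> E (u\<^sub>k\<^sup>2 S\<^sub>k\<^sub>-\<^sub>1) \<le> E (u\<^sub>k\<^sup>2 S\<^sub>n)\<close>, and summation
  gives the constant \<open>3/2 + 1/2 = 2\<close>.\<close>

text \<open>With \<open>b = sqrt (a^2 + f^2)\<close>, AM-GM applied to \<open>f\<close> and
  \<open>v * b\<close> bounds \<open>2 * f * v * b\<close> by \<open>f^2 + v^2 * b^2\<close>, where
  \<open>f^2 = (b - a) * (b + a)\<close> is at most \<open>2 * b * (b - a)\<close>. Dividing by
  \<open>2 * b\<close> leaves \<open>(b - a) + v^2 * b / 2\<close>. Replacing \<open>b\<close> by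
  \<open>a\<close> in the last term costs at most another \<open>(b - a) / 2\<close>, whence the
  factor 3/2.\<close>

lemma mult_le_sqrt_increment:
  fixes a f v :: real
  assumes "0 \<le> a" "\<bar>v\<bar> \<le> 1"
  shows "f * v \<le> 3/2 * (sqrt (a\<^sup>2 + f\<^sup>2) - a) + 1/2 * (v\<^sup>2 * a)"
proof -
  define b where "b = sqrt (a\<^sup>2 + f\<^sup>2)"
  have b: "b\<^sup>2 = a\<^sup>2 + f\<^sup>2" and ab: "a \<le> b"
    unfolding b_def by (auto intro: real_le_rsqrt)
  have v: "v\<^sup>2 \<le> 1" using assms by (simp add: abs_square_le_1)
  show ?thesis
  \<comment> \<open>The main case divides by \<open>b\<close>; if \<open>b = 0\<close>, then
    \<open>a\<close> and \<open>f\<close> vanish too.\<close>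
  proof (cases "b = 0")
    case True
    then show ?thesis using b assms ab by (simp add: b_def)
  next
    case False
    then have bpos: "0 < b" using ab assms by linarith
    have "2 * (f * v) * b \<le> f\<^sup>2 + (v * b)\<^sup>2"
      using sum_squares_bound[of f "v * b"] by (simp add: mult_ac)
    also have "\<dots> = (b - a) * (b + a) + v\<^sup>2 * b * b"
      using b by (simp add: algebra_simps power2_eq_square)
    also have "\<dots> \<le> (b - a) * (2 * b) + v\<^sup>2 * b * b"
      using ab by (intro add_right_mono mult_left_mono) auto
    also have "\<dots> = (2 * (b - a) + v\<^sup>2 * b) * b" by (simp add: algebra_simps)
    finally have "2 * (f * v) \<le> 2 * (b - a) + v\<^sup>2 * b" using bpos by simp
    moreover have "v\<^sup>2 * (b - a) \<le> 1 * (b - a)"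
      using v ab by (intro mult_right_mono) auto
    ultimately show ?thesis by (simp add: b_def[symmetric] field_simps)
  qed
qed

context finite_measure_subalgebra
begin

lemma real_cond_exp_bounded_AE:
  assumes "u \<in> borel_measurable M" "\<And>x. \<bar>u x\<bar> \<le> (c::real)"
  shows "AE x in M. \<bar>real_cond_exp M F u x\<bar> \<le> c"
proof -
  have i: "integrable M u"
    using assms by (intro integrable_const_bound[where B=c]) auto
  have "AE x in M. real_cond_exp M F u x \<le> c"
    by (rule real_cond_exp_le_c[OF i]) (use assms(2) in \<open>auto simp: abs_le_iff\<close>)
  moreover have "AE x in M. real_cond_exp M F u x \<ge> -c"
    by (rule real_cond_exp_ge_c[OF i]) (use assms(2) in \<open>auto simp: abs_le_iff minus_le_iff\<close>)
  ultimately show ?thesis by eventually_elim auto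
qed

text \<open>Self-adjointness of conditional expectation in the pairing of an integrable with a
  bounded function: both integrals equal that of the product of the two conditional expectations.
  The bound on \<open>u\<close> supplies integrability of the products.\<close>

lemma integral_real_cond_exp_mult:
  assumes u: "u \<in> borel_measurable M" "\<And>x. \<bar>u x\<bar> \<le> (c::real)" and f: "integrable M f"
  shows "integrable M (\<lambda>x. real_cond_exp M F f x * u x)"
    and "integrable M (\<lambda>x. f x * real_cond_exp M F u x)"
    and "(\<integral>x. real_cond_exp M F f x * u x \<partial>M) = (\<integral>x. f x * real_cond_exp M F u x \<partial>M)"
proof -
  let ?v = "real_cond_exp M F u" and ?g = "real_cond_exp M F f"
  have fm: "f \<in> borel_measurable M" using f by simp
  have g: "integrable M ?g" by (rule real_cond_exp_int(1)[OF f])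
  have v: "AE x in M. \<bar>?v x\<bar> \<le> c" by (rule real_cond_exp_bounded_AE[OF u])
  show gu: "integrable M (\<lambda>x. ?g x * u x)"
  proof (rule Bochner_Integration.integrable_bound[where f="\<lambda>x. c * ?g x"])
    show "AE x in M. norm (?g x * u x) \<le> norm (c * ?g x)"
      using order_trans[OF u(2) abs_ge_self]
      by (intro AE_I2) (simp add: abs_mult mult.commute[of "\<bar>u _\<bar>"] mult.commute[of "\<bar>c\<bar>"] mult_left_mono)
  qed (use g u in auto)
  show fv: "integrable M (\<lambda>x. f x * ?v x)"
  proof (rule Bochner_Integration.integrable_bound[where f="\<lambda>x. c * f x"])
    show "AE x in M. norm (f x * ?v x) \<le> norm (c * f x)"
      using v by eventually_elim
        (auto simp: abs_mult mult.commute[of "\<bar>f _\<bar>"]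
          intro!: mult_right_mono intro: order_trans[OF _ abs_ge_self])
  qed (use f in auto)
  \<comment> \<open>Since \<open>?g\<close> is measurable for \<open>F\<close>, \<open>u\<close> may
    be projected to \<open>?v\<close>; next, since \<open>?v\<close> is too, the projection
    \<open>?g\<close> may be undone to \<open>f\<close>.\<close>
  have "(\<integral>x. ?g x * u x \<partial>M) = (\<integral>x. ?g x * ?v x \<partial>M)"
    using gu u by (intro real_cond_exp_intg(2)[symmetric]) auto
  also have "\<dots> = (\<integral>x. ?v x * f x \<partial>M)"
    using fv fm by (subst mult.commute, intro real_cond_exp_intg(2)) (auto simp: mult.commute)
  finally show "(\<integral>x. ?g x * u x \<partial>M) = (\<integral>x. f x * ?v x \<partial>M)" by (simp add: mult.commute)
qed

text \<open>A weighted form of the L2 contraction property. As the weight \<open>a\<close> is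
  measurable for \<open>F\<close>, \<open>u - ?v\<close> is orthogonal to \<open>?v * a\<close>, so
  the nonnegative integral of \<open>(u - ?v)^2 * a\<close> is exactly the difference of the two
  sides.\<close>

lemma integral_real_cond_exp_square_mult_le:
  assumes u: "u \<in> borel_measurable M" "\<And>x. \<bar>u x\<bar> \<le> (c::real)"
    and a: "integrable M a" "a \<in> borel_measurable F" "\<And>x. 0 \<le> a x"
  shows "integrable M (\<lambda>x. (real_cond_exp M F u x)\<^sup>2 * a x)"
    and "integrable M (\<lambda>x. (u x)\<^sup>2 * a x)"
    and "(\<integral>x. (real_cond_exp M F u x)\<^sup>2 * a x \<partial>M) \<le> (\<integral>x. (u x)\<^sup>2 * a x \<partial>M)"
proof -
  let ?v = "real_cond_exp M F u"
  have v: "AE x in M. \<bar>?v x\<bar> \<le> c" by (rule real_cond_exp_bounded_AE[OF u])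
  have prod: "integrable M (\<lambda>x. p x * q x * a x)"
    if "p \<in> borel_measurable M" "q \<in> borel_measurable M"
      "AE x in M. \<bar>p x\<bar> \<le> c" "AE x in M. \<bar>q x\<bar> \<le> c" for p q
  proof (rule Bochner_Integration.integrable_bound[where f="\<lambda>x. c * c * a x"])
    show "AE x in M. norm (p x * q x * a x) \<le> norm (c * c * a x)"
      using that(3,4) by eventually_elim
        (use a(3) in \<open>auto simp: abs_mult intro!: mult_mono intro: order_trans[OF _ abs_ge_self]\<close>)
  qed (use that a in auto)
  show vv: "integrable M (\<lambda>x. (?v x)\<^sup>2 * a x)"
    unfolding power2_eq_square using v by (intro prod) auto
  show uu: "integrable M (\<lambda>x. (u x)\<^sup>2 * a x)"
    unfolding power2_eq_square using u by (intro prod) auto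
  have uv: "integrable M (\<lambda>x. (?v x * a x) * u x)"
    using prod[of ?v u] u v by (simp add: mult_ac)
  have eq: "(\<integral>x. (?v x * a x) * u x \<partial>M) = (\<integral>x. (?v x)\<^sup>2 * a x \<partial>M)"
    using real_cond_exp_intg(2)[OF uv] u a by (simp add: power2_eq_square mult_ac)
  have "0 \<le> (\<integral>x. (u x - ?v x)\<^sup>2 * a x \<partial>M)"
    using a by (intro integral_nonneg_AE) auto
  also have "\<dots> = (\<integral>x. (u x)\<^sup>2 * a x - 2 * ((?v x * a x) * u x) + (?v x)\<^sup>2 * a x \<partial>M)"
    by (intro Bochner_Integration.integral_cong) (auto simp: algebra_simps power2_eq_square)
  also have "\<dots> = (\<integral>x. (u x)\<^sup>2 * a x \<partial>M) - (\<integral>x. (?v x)\<^sup>2 * a x \<partial>M)"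
    using uu uv vv eq by simp
  finally show "(\<integral>x. (?v x)\<^sup>2 * a x \<partial>M) \<le> (\<integral>x. (u x)\<^sup>2 * a x \<partial>M)" by simp
qed

end

lemma integrable_L2_set:
  assumes "\<And>k. k \<in> A \<Longrightarrow> integrable M (f k)"
  shows "integrable M (\<lambda>x. L2_set (\<lambda>k. f k x) A)"
proof (rule Bochner_Integration.integrable_bound[where f="\<lambda>x. \<Sum>k\<in>A. \<bar>f k x\<bar>"])
  show "AE x in M. norm (L2_set (\<lambda>k. f k x) A) \<le> norm (\<Sum>k\<in>A. \<bar>f k x\<bar>)"
    by (intro AE_I2) (simp add: L2_set_le_sum_abs sum_nonneg)
qed (use assms in \<open>auto simp: L2_set_def\<close>)

text \<open>The core estimate, to be applied to the moduli of the martingale differences.\<close>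

theorem lepingle_inequality:
  fixes f :: "nat \<Rightarrow> 'a \<Rightarrow> real"
  assumes filt: "filtered_prob_space M \<F> n"
    and adapted: "\<And>k. k \<in> {1..n} \<Longrightarrow> f k \<in> borel_measurable (\<F> k)"
    and int: "\<And>k. k \<in> {1..n} \<Longrightarrow> integrable M (f k)"
  shows "(\<integral>x. L2_set (\<lambda>k. real_cond_exp M (\<F> (k - 1)) (f k) x) {1..n} \<partial>M)
    \<le> 2 * (\<integral>x. L2_set (\<lambda>k. f k x) {1..n} \<partial>M)"
proof -
  interpret prob_space M using filt by (simp add: filtered_prob_space_def)
  have sub: "finite_measure_subalgebra M (\<F> k)" if "k \<le> n" for k
    using filt that
    by unfold_locales (auto simp: filtered_prob_space_def)
  define g where "g k = real_cond_exp M (\<F> (k - 1)) (f k)" for k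
  define G where "G x = L2_set (\<lambda>k. g k x) {1..n}" for x
  \<comment> \<open>At points where \<open>G x = 0\<close>, division by zero makes
    \<open>u k x = 0\<close>, and each \<open>g k x\<close> with \<open>k\<close> in
    \<open>{1..n}\<close> vanishes; the identity \<open>sum_gu\<close> and the bound
    \<open>sum_u\<close> survive there.\<close>
  define u where "u k x = g k x / G x" for k x
  define v where "v k = real_cond_exp M (\<F> (k - 1)) (u k)" for k
  define S where "S k x = L2_set (\<lambda>j. f j x) {1..k}" for k x
  have G_sq: "(G x)\<^sup>2 = (\<Sum>k=1..n. (g k x)\<^sup>2)" for x
    by (simp add: G_def L2_set_def sum_nonneg)
  have sum_gu: "(\<Sum>k=1..n. g k x * u k x) = G x" for x
  proof -
    have "(\<Sum>k=1..n. g k x * u k x) = (G x)\<^sup>2 / G x"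
      unfolding G_sq by (simp add: u_def power2_eq_square sum_divide_distrib)
    then show ?thesis by (simp add: power2_eq_square)
  qed
  have sum_u: "(\<Sum>k=1..n. (u k x)\<^sup>2) \<le> 1" for x
  proof -
    have "(\<Sum>k=1..n. (u k x)\<^sup>2) = (G x)\<^sup>2 / (G x)\<^sup>2"
      unfolding G_sq by (simp add: u_def power_divide sum_divide_distrib[symmetric] G_sq)
    then show ?thesis by (cases "G x = 0") auto
  qed
  have u_le: "\<bar>u k x\<bar> \<le> 1" if "k \<in> {1..n}" for k x
  proof -
    have "(u k x)\<^sup>2 \<le> (\<Sum>k=1..n. (u k x)\<^sup>2)"
      using that by (intro member_le_sum) auto
    also have "\<dots> \<le> 1" by (rule sum_u)
    finally show ?thesis by (simp add: abs_square_le_1)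
  qed
  have u_meas: "u k \<in> borel_measurable M" for k
    unfolding u_def G_def L2_set_def g_def by simp
  have S_int: "integrable M (S k)" if "k \<le> n" for k
    unfolding S_def using that by (intro integrable_L2_set int) auto
  have S_nonneg: "0 \<le> S k x" for k x by (simp add: S_def)
  have S_mono: "S k x \<le> S n x" if "k \<le> n" for k x
    unfolding S_def L2_set_def using that
    by (intro real_sqrt_le_mono sum_mono2) auto
  \<comment> \<open>Predictability of the weight \<open>S (k - 1)\<close>, which lets it pass
    through the conditioning at time \<open>k - 1\<close>. For \<open>k = 1\<close> it is the empty
    sum, so \<open>S 0 = 0\<close>; the telescoping below relies on this value.\<close>
  have S_meas: "S (k - 1) \<in> borel_measurable (\<F> (k - 1))" if "k \<in> {1..n}" for k
  proof -
    have "f j \<in> borel_measurable (\<F> (k - 1))" if "j \<in> {1..k - 1}" for j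
    proof (rule measurable_from_subalg[OF _ adapted])
      have "j \<le> k - 1" "j \<le> n" "k - 1 \<le> n" using that \<open>k \<in> {1..n}\<close> by auto
      then show "subalgebra (\<F> (k - 1)) (\<F> j)"
        using filt unfolding filtered_prob_space_def subalgebra_def by metis
    qed (use that \<open>k \<in> {1..n}\<close> in auto)
    then show ?thesis unfolding S_def L2_set_def by measurable
  qed
  have S_step: "S k x = sqrt ((S (k - 1) x)\<^sup>2 + (f k x)\<^sup>2)" if "k \<in> {1..n}" for k x
    using that by (cases k) (auto simp: S_def L2_set_def sum_nonneg)
  have S_telescope: "(\<Sum>k=1..n. S k x - S (k - 1) x) = S n x" for x
  proof -
    have "(\<Sum>k=1..m. S k x - S (k - 1) x) = S m x" for m
      by (induction m) (auto simp: S_def)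
    then show ?thesis .
  qed
  have term_le: "(\<integral>x. g k x * u k x \<partial>M)
      \<le> 3/2 * (\<integral>x. S k x - S (k - 1) x \<partial>M) + 1/2 * (\<integral>x. (u k x)\<^sup>2 * S n x \<partial>M)"
    and gu_int: "integrable M (\<lambda>x. g k x * u k x)"
    and uS_int: "integrable M (\<lambda>x. (u k x)\<^sup>2 * S n x)"
    if k: "k \<in> {1..n}" for k
  proof -
    interpret A: finite_measure_subalgebra M "\<F> (k - 1)" using sub k by auto
    have ab: "integrable M (S k)" "integrable M (S (k - 1))" "integrable M (S n)"
      using S_int k by auto
    note dual = A.integral_real_cond_exp_mult[OF u_meas u_le[OF k] int[OF k], folded g_def v_def]
    note sq = A.integral_real_cond_exp_square_mult_le
      [OF u_meas u_le[OF k] ab(2) S_meas[OF k] S_nonneg, folded v_def]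
    show "integrable M (\<lambda>x. g k x * u k x)" by (rule dual(1))
    show uS: "integrable M (\<lambda>x. (u k x)\<^sup>2 * S n x)"
    proof (rule Bochner_Integration.integrable_bound[OF ab(3)])
      show "AE x in M. norm ((u k x)\<^sup>2 * S n x) \<le> norm (S n x)"
        using u_le[OF k] S_nonneg
        by (intro AE_I2) (simp add: abs_mult mult_left_le_one_le abs_square_le_1)
    qed (use u_meas ab in auto)
    have "AE x in M. \<bar>v k x\<bar> \<le> 1"
      unfolding v_def by (rule A.real_cond_exp_bounded_AE[OF u_meas u_le[OF k]])
    then have "AE x in M. f k x * v k x
        \<le> 3/2 * (S k x - S (k - 1) x) + 1/2 * ((v k x)\<^sup>2 * S (k - 1) x)"
      by eventually_elim (simp only: S_step[OF k] mult_le_sqrt_increment[OF S_nonneg])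
    then have "(\<integral>x. f k x * v k x \<partial>M)
        \<le> (\<integral>x. 3/2 * (S k x - S (k - 1) x) + 1/2 * ((v k x)\<^sup>2 * S (k - 1) x) \<partial>M)"
      using dual(2) sq(1) ab by (intro integral_mono_AE) auto
    also have "\<dots> = 3/2 * (\<integral>x. S k x - S (k - 1) x \<partial>M)
        + 1/2 * (\<integral>x. (v k x)\<^sup>2 * S (k - 1) x \<partial>M)"
      using sq(1) ab by simp
    finally have "(\<integral>x. g k x * u k x \<partial>M) \<le> 3/2 * (\<integral>x. S k x - S (k - 1) x \<partial>M)
        + 1/2 * (\<integral>x. (v k x)\<^sup>2 * S (k - 1) x \<partial>M)"
      unfolding dual(3) .
    \<comment> \<open>The weight is enlarged to \<open>S n\<close>, common to all \<open>k\<close>,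
      so that \<open>sum_u\<close> can be used after summation. This comes after passing from
      \<open>v\<close> to \<open>u\<close>, where the weight had to be measurable at time
      \<open>k - 1\<close>.\<close>
    moreover have "(\<integral>x. (u k x)\<^sup>2 * S (k - 1) x \<partial>M) \<le> (\<integral>x. (u k x)\<^sup>2 * S n x \<partial>M)"
      using sq(2) uS k by (intro integral_mono mult_left_mono S_mono) auto
    ultimately show "(\<integral>x. g k x * u k x \<partial>M)
      \<le> 3/2 * (\<integral>x. S k x - S (k - 1) x \<partial>M) + 1/2 * (\<integral>x. (u k x)\<^sup>2 * S n x \<partial>M)"
      using sq(3) by linarith
  qed
  have "(\<integral>x. G x \<partial>M) = (\<Sum>k=1..n. \<integral>x. g k x * u k x \<partial>M)"
    unfolding sum_gu[symmetric] using gu_int by simp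
  also have "\<dots> \<le> (\<Sum>k=1..n. 3/2 * (\<integral>x. S k x - S (k - 1) x \<partial>M)
      + 1/2 * (\<integral>x. (u k x)\<^sup>2 * S n x \<partial>M))"
    by (intro sum_mono term_le)
  also have "\<dots> = 3/2 * (\<Sum>k=1..n. \<integral>x. S k x - S (k - 1) x \<partial>M)
      + 1/2 * (\<Sum>k=1..n. \<integral>x. (u k x)\<^sup>2 * S n x \<partial>M)"
    by (simp add: sum.distrib sum_distrib_left)
  also have "(\<Sum>k=1..n. \<integral>x. S k x - S (k - 1) x \<partial>M) = (\<integral>x. S n x \<partial>M)"
    unfolding S_telescope[symmetric]
    using S_int by (subst Bochner_Integration.integral_sum) auto
  also have "(\<Sum>k=1..n. \<integral>x. (u k x)\<^sup>2 * S n x \<partial>M) = (\<integral>x. (\<Sum>k=1..n. (u k x)\<^sup>2) * S n x \<partial>M)"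
    using uS_int by (simp add: sum_distrib_right)
  \<comment> \<open>Here \<open>sum_u\<close> is used pointwise; the contributions 3/2 and 1/2 of
    \<open>S n\<close> then add up to 2.\<close>
  also have "\<dots> \<le> (\<integral>x. S n x \<partial>M)"
  proof (rule integral_mono)
    show "integrable M (\<lambda>x. (\<Sum>k=1..n. (u k x)\<^sup>2) * S n x)"
      unfolding sum_distrib_right by (intro Bochner_Integration.integrable_sum uS_int)
  qed (use S_int sum_u S_nonneg in \<open>auto intro!: mult_left_le_one_le sum_nonneg\<close>)
  finally show ?thesis by (simp add: G_def g_def S_def)
qed

theorem proposition4p2:
  fixes M :: "'a measure" and \<F> :: "nat \<Rightarrow> 'a measure" and n :: nat
    and F :: "nat \<Rightarrow> 'a \<Rightarrow> complex"
  assumes "filtered_prob_space M \<F> n"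
    and "integrable_martingale M \<F> n F"
  shows "(\<integral>\<^sup>+\<omega>. ennreal (sqrt (\<Sum>k=1..n.
            (real_cond_exp M (\<F> (k - 1)) (\<lambda>x. cmod (mart_diff F k x)) \<omega>)\<^sup>2)) \<partial>M)
    \<le> 2 * (\<integral>\<^sup>+\<omega>. ennreal (sqrt (\<Sum>k=1..n. (cmod (mart_diff F k \<omega>))\<^sup>2)) \<partial>M)"
proof -
  define f where "f k x = cmod (mart_diff F k x)" for k x
  interpret prob_space M using assms(1) by (simp add: filtered_prob_space_def)
  have f_int: "integrable M (f k)" if "k \<in> {1..n}" for k
    unfolding f_def mart_diff_def using assms(2) that
    by (intro integrable_norm Bochner_Integration.integrable_diff)
      (auto simp: integrable_martingale_def)
  have f_meas: "f k \<in> borel_measurable (\<F> k)" if "k \<in> {1..n}" for k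
  proof -
    have "subalgebra (\<F> k) (\<F> (k - 1))"
      using assms(1) that by (auto simp: filtered_prob_space_def subalgebra_def)
    moreover have "F (k - 1) \<in> borel_measurable (\<F> (k - 1))"
      using assms(2) that by (auto simp: integrable_martingale_def)
    ultimately have "F (k - 1) \<in> borel_measurable (\<F> k)"
      by (rule measurable_from_subalg)
    moreover have "F k \<in> borel_measurable (\<F> k)"
      using assms(2) that by (auto simp: integrable_martingale_def)
    ultimately show ?thesis unfolding f_def mart_diff_def by measurable
  qed
  have g_int: "integrable M (real_cond_exp M (\<F> (k - 1)) (f k))" if "k \<in> {1..n}" for k
  proof -
    interpret finite_measure_subalgebra M "\<F> (k - 1)"
      using assms(1) that by unfold_locales (auto simp: filtered_prob_space_def)
    show ?thesis using f_int[OF that] by (rule real_cond_exp_int(1))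
  qed
  have "ennreal (\<integral>x. L2_set (\<lambda>k. real_cond_exp M (\<F> (k - 1)) (f k) x) {1..n} \<partial>M)
      \<le> 2 * ennreal (\<integral>x. L2_set (\<lambda>k. f k x) {1..n} \<partial>M)"
    using ennreal_leI[OF lepingle_inequality[OF assms(1) f_meas f_int]]
    by (simp add: ennreal_mult')
  \<comment> \<open>A finite family of integrable functions has an integrable square function, so
    both extended integrals are finite and agree with the real ones.\<close>
  moreover have "(\<integral>\<^sup>+x. L2_set (\<lambda>k. h k x) {1..n} \<partial>M) = ennreal (\<integral>x. L2_set (\<lambda>k. h k x) {1..n} \<partial>M)"
    if "\<And>k. k \<in> {1..n} \<Longrightarrow> integrable M (h k)" for h
    using that by (intro nn_integral_eq_integral integrable_L2_set) auto
  ultimately have "(\<integral>\<^sup>+x. L2_set (\<lambda>k. real_cond_exp M (\<F> (k - 1)) (f k) x) {1..n} \<partial>M)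
      \<le> 2 * (\<integral>\<^sup>+x. L2_set (\<lambda>k. f k x) {1..n} \<partial>M)"
    using f_int g_int by presburger
  then show ?thesis by (simp add: f_def[abs_def] L2_set_def)
qed

end
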